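(* Let $f:\{0,1\}^n\to\{0,1\}$ be constant or balanced, and let $V=(H^{\otimes(n+1)})\,U_f\,(H^{\otimes(n+1)})$ be the Deutsch–Jozsa circuit on $n$ input qubits and one work qubit, where $U_f|x\rangle|w\rangle=|x\rangle|w\oplus f(x)\rangle$. For an output state $\rho$ write $E_i(\rho)=\mathrm{Tr}(\rho Z^{(i)})$, $1\le i\le n$. (a) Suppose the work qubit starts in $|1\rangle$. Let $E_i^{P}$ be the value of $E_i$ on the output when the input qubits start in $|0\rangle^{\otimes n}$, and let $E_i^{T}$ be its value when the input qubits start in the product state in which the $i$-th qubit is $p_i|0\rangle\langle0|+(1-p_i)|1\rangle\langle1|$, with $0\le p_i\le1$. Then $E_i^{T}=(2p_i-1)E_i^{P}$ for every $i$. (b) Let $\tfrac12<p\le1$, and suppose each input qubit starts in $p|0\rangle\langle0|+(1-p)|1\rangle\langle1|$ and the work qubit starts in $p|1\rangle\langle1|+(1-p)|0\rangle\langle0|$, all independently. Then on the output $\sum_{i=1}^nE_i=(2p-1)n$ if $f$ is constant, and $\sum_{i=1}^nE_i\le(2p-1)(n-2p)$ if $f$ is balanced.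
   Context: $f$ is balanced if $|\{x:f(x)=0\}|=|\{x:f(x)=1\}|$. $H=\frac1{\sqrt2}\begin{bmatrix}1&1\\1&-1\end{bmatrix}$ is the Hadamard gate, $Z=\mathrm{diag}(1,-1)$, and $Z^{(i)}$ is $Z$ acting on the $i$-th input qubit. *)

theory Defs
  imports Jordan_Normal_Form.Schur_Decomposition
begin

text \<open>
  A register of \<open>m\<close> qubits is modelled by complex matrices of dimension \<open>2 ^ m\<close>; operators on it are
  iterated Kronecker products whose first factor acts on the first qubit. For the Deutsch-Jozsa
  circuit \<open>m = n + 1\<close>: qubits \<open>1, ..., n\<close> are the input qubits and qubit \<open>n + 1\<close> is the work qubit.
  Bits are booleans, and an element of \<open>{0,1}^n\<close> is a \<^typ>\<open>bool list\<close> of length \<open>n\<close>.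
\<close>

definition bitstrings :: "nat \<Rightarrow> bool list set" where
  "bitstrings n = {x. length x = n}"

definition constant_fun :: "nat \<Rightarrow> (bool list \<Rightarrow> bool) \<Rightarrow> bool" where
  "constant_fun n f \<longleftrightarrow> (\<exists>c. \<forall>x\<in>bitstrings n. f x = c)"

definition balanced_fun :: "nat \<Rightarrow> (bool list \<Rightarrow> bool) \<Rightarrow> bool" where
  "balanced_fun n f \<longleftrightarrow> card {x \<in> bitstrings n. \<not> f x} = card {x \<in> bitstrings n. f x}"

definition kron :: "complex mat \<Rightarrow> complex mat \<Rightarrow> complex mat" where
  "kron A B = mat (dim_row A * dim_row B) (dim_col A * dim_col B)
     (\<lambda>(r, c). A $$ (r div dim_row B, c div dim_col B) * B $$ (r mod dim_row B, c mod dim_col B))"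

definition tensor :: "complex mat list \<Rightarrow> complex mat" where
  "tensor As = foldr kron As (1\<^sub>m 1)"

definition mat_trace :: "complex mat \<Rightarrow> complex" where
  "mat_trace A = (\<Sum>k<dim_row A. A $$ (k, k))"

definition hadamard :: "complex mat" where
  "hadamard = complex_of_real (1 / sqrt 2) \<cdot>\<^sub>m mat_of_rows_list 2 [[1, 1], [1, -1]]"

definition pauli_Z :: "complex mat" where
  "pauli_Z = mat_of_rows_list 2 [[1, 0], [0, -1]]"

definition ket :: "bool \<Rightarrow> complex mat" where
  "ket b = mat_of_rows_list 1 (if b then [[0], [1]] else [[1], [0]])"

definition basis_ket :: "bool list \<Rightarrow> complex mat" where
  "basis_ket x = tensor (map ket x)"

definition proj :: "bool \<Rightarrow> complex mat" where
  "proj b = ket b * mat_adjoint (ket b)"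

text \<open>The state \<open>p |0><0| + (1 - p) |1><1|\<close> of a single qubit.\<close>

definition qubit_mix :: "real \<Rightarrow> complex mat" where
  "qubit_mix p = complex_of_real p \<cdot>\<^sub>m proj False + complex_of_real (1 - p) \<cdot>\<^sub>m proj True"

text \<open>
  \<open>U_f\<close> is the sum of \<open>|x, w + f x><x, w|\<close> over all basis states, where \<open>w + f x\<close> (addition of bits
  modulo 2) is \<^term>\<open>w \<noteq> f x\<close> on booleans; see \<open>dj_U_basis_ket\<close> below.
\<close>

definition dj_U :: "nat \<Rightarrow> (bool list \<Rightarrow> bool) \<Rightarrow> complex mat" where
  "dj_U n f = mat (2 ^ (n + 1)) (2 ^ (n + 1)) (\<lambda>(r, c).
     \<Sum>x\<in>bitstrings n. \<Sum>w\<in>UNIV.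
       (basis_ket (x @ [w \<noteq> f x]) * mat_adjoint (basis_ket (x @ [w]))) $$ (r, c))"

definition dj_circuit :: "nat \<Rightarrow> (bool list \<Rightarrow> bool) \<Rightarrow> complex mat" where
  "dj_circuit n f =
     tensor (replicate (n + 1) hadamard) * dj_U n f * tensor (replicate (n + 1) hadamard)"

definition dj_input :: "nat \<Rightarrow> (nat \<Rightarrow> complex mat) \<Rightarrow> complex mat \<Rightarrow> complex mat" where
  "dj_input n \<sigma> \<omega> = tensor (map \<sigma> [1..<n + 1] @ [\<omega>])"

definition dj_output :: "nat \<Rightarrow> (bool list \<Rightarrow> bool) \<Rightarrow> complex mat \<Rightarrow> complex mat" where
  "dj_output n f \<rho> = dj_circuit n f * \<rho> * mat_adjoint (dj_circuit n f)"

definition Z_on :: "nat \<Rightarrow> nat \<Rightarrow> complex mat" where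
  "Z_on n i = tensor (map (\<lambda>j. if j = i then pauli_Z else 1\<^sub>m 2) [1..<n + 2])"

text \<open>
  Expectations are kept complex-valued. An inequality between them, in the order of
  \<open>HOL-Library.Complex_Order\<close>, includes equality of imaginary parts.
\<close>

definition expect_Z :: "nat \<Rightarrow> nat \<Rightarrow> complex mat \<Rightarrow> complex" where
  "expect_Z n i \<rho> = mat_trace (\<rho> * Z_on n i)"


fun bits_to_nat :: "bool list \<Rightarrow> nat" where
  "bits_to_nat [] = 0"
| "bits_to_nat (b # bs) = of_bool b * 2 ^ length bs + bits_to_nat bs"

lemma bits_to_nat_less: "bits_to_nat x < 2 ^ length x"
  by (induction x) auto

lemma bits_to_nat_inj:
  "length x = length y \<Longrightarrow> bits_to_nat x = bits_to_nat y \<longleftrightarrow> x = y"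
proof (induction x y rule: list_induct2)
  case (Cons a x b y)
  have "bits_to_nat x < 2 ^ length y" "bits_to_nat y < 2 ^ length y"
    using bits_to_nat_less[of x] bits_to_nat_less[of y] Cons by auto
  then show ?case using Cons by (cases a; cases b) auto
qed auto

lemma tensor_Nil [simp]: "tensor [] = 1\<^sub>m 1"
  and tensor_Cons [simp]: "tensor (A # As) = kron A (tensor As)"
  by (simp_all add: tensor_def)

lemma dim_ket [simp]: "dim_row (ket b) = 2" "dim_col (ket b) = 1"
  by (auto simp: ket_def mat_of_rows_list_def)

lemma dim_basis_ket [simp]:
  "dim_row (basis_ket x) = 2 ^ length x" "dim_col (basis_ket x) = 1"
  by (induction x) (auto simp: basis_ket_def kron_def)

lemma ket_index: "r < 2 \<Longrightarrow> ket b $$ (r, 0) = of_bool (r = of_bool b)"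
  by (cases "r = 0"; cases "r = 1") (auto simp: ket_def mat_of_rows_list_def)

lemma basis_ket_index:
  "r < 2 ^ length x \<Longrightarrow> basis_ket x $$ (r, 0) = of_bool (r = bits_to_nat x)"
proof (induction x arbitrary: r)
  case Nil
  then show ?case by (simp add: basis_ket_def)
next
  case (Cons b x)
  let ?m = "2 ^ length x :: nat"
  have eq: "basis_ket (b # x) = kron (ket b) (basis_ket x)"
    by (simp add: basis_ket_def)
  have "basis_ket (b # x) $$ (r, 0) = ket b $$ (r div ?m, 0) * basis_ket x $$ (r mod ?m, 0)"
    unfolding eq kron_def using Cons.prems by simp
  also have "r div ?m < 2" using Cons.prems
    by (simp add: less_mult_imp_div_less)
  then have "ket b $$ (r div ?m, 0) = of_bool (r div ?m = of_bool b)"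
    by (rule ket_index)
  also have "basis_ket x $$ (r mod ?m, 0) = of_bool (r mod ?m = bits_to_nat x)"
    by (rule Cons.IH) simp
  also have "of_bool (r div ?m = of_bool b) * of_bool (r mod ?m = bits_to_nat x)
      = (of_bool (r = bits_to_nat (b # x)) :: complex)"
  proof -
    have "r = bits_to_nat (b # x) \<longleftrightarrow> r div ?m = of_bool b \<and> r mod ?m = bits_to_nat x"
    proof
      assume "r = bits_to_nat (b # x)"
      then show "r div ?m = of_bool b \<and> r mod ?m = bits_to_nat x"
        using bits_to_nat_less[of x] by simp
    next
      assume "r div ?m = of_bool b \<and> r mod ?m = bits_to_nat x"
      then show "r = bits_to_nat (b # x)"
        using div_mult_mod_eq[of r ?m] by simp
    qed
    then show ?thesis by auto
  qed
  finally show ?case .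
qed

lemma dj_U_index:
  assumes "r < 2 ^ (n + 1)" "length z = n" 
  shows "dj_U n f $$ (r, bits_to_nat (z @ [w])) = of_bool (r = bits_to_nat (z @ [w \<noteq> f z]))"
proof -
  have fin: "finite (bitstrings n)"
    using finite_lists_length_eq[of "UNIV :: bool set" n] by (simp add: bitstrings_def)
  have c: "bits_to_nat (z @ [w]) < 2 ^ (n + 1)"
    using bits_to_nat_less[of "z @ [w]"] assms by simp
  have entry: "(basis_ket (x @ [v \<noteq> f x]) * mat_adjoint (basis_ket (x @ [v]))) $$ (r, bits_to_nat (z @ [w]))
      = of_bool (r = bits_to_nat (x @ [v \<noteq> f x])) * of_bool (z @ [w] = x @ [v])"
    if "x \<in> bitstrings n" for x v
  proof -
    have "length x = n" using that by (simp add: bitstrings_def)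
    then have "bits_to_nat (z @ [w]) = bits_to_nat (x @ [v]) \<longleftrightarrow> z @ [w] = x @ [v]"
      using assms by (intro bits_to_nat_inj) simp
    then show ?thesis using assms c \<open>length x = n\<close>
      by (simp add: scalar_prod_def mat_adjoint_def basis_ket_index mat_of_rows_index
          del: append1_eq_conv)
  qed
  have "dj_U n f $$ (r, bits_to_nat (z @ [w])) = (\<Sum>x\<in>bitstrings n. \<Sum>v\<in>UNIV.
      of_bool (r = bits_to_nat (x @ [v \<noteq> f x])) * of_bool (z @ [w] = x @ [v]))"
    unfolding dj_U_def using assms c entry by (simp cong: sum.cong)
  also have "\<dots> = (\<Sum>x\<in>bitstrings n. if z = x then of_bool (r = bits_to_nat (z @ [w \<noteq> f z])) else 0)"
  proof (intro sum.cong refl)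
    fix x assume "x \<in> bitstrings n"
    have two: "(\<Sum>v\<in>UNIV. g v) = g False + g True" for g :: "bool \<Rightarrow> complex"
      by (simp add: UNIV_bool)
    show "(\<Sum>v\<in>UNIV. of_bool (r = bits_to_nat (x @ [v \<noteq> f x])) * of_bool (z @ [w] = x @ [v]))
        = (if z = x then of_bool (r = bits_to_nat (z @ [w \<noteq> f z])) else (0 :: complex))"
      unfolding two by (cases w) auto
  qed
  also have "\<dots> = of_bool (r = bits_to_nat (z @ [w \<noteq> f z]))"
    using fin assms by (simp add: bitstrings_def)
  finally show ?thesis .
qed

lemma dj_U_basis_ket:
  assumes "length x = n"
  shows "dj_U n f * basis_ket (x @ [w]) = basis_ket (x @ [w \<noteq> f x])"
proof (rule eq_matI)
  fix r c assume *: "r < dim_row (basis_ket (x @ [w \<noteq> f x]))" "c < dim_col (basis_ket (x @ [w \<noteq> f x]))"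
  have "bits_to_nat (x @ [w]) < 2 ^ (n + 1)"
    using bits_to_nat_less[of "x @ [w]"] assms by simp
  moreover have d: "dim_row (dj_U n f) = 2 ^ (n + 1)" "dim_col (dj_U n f) = 2 ^ (n + 1)"
    by (auto simp: dj_U_def)
  ultimately have "(dj_U n f * basis_ket (x @ [w])) $$ (r, c)
      = (\<Sum>k = 0..<2 ^ (n + 1). if k = bits_to_nat (x @ [w]) then dj_U n f $$ (r, k) else 0)"
    using * assms by (auto simp: scalar_prod_def basis_ket_index intro!: sum.cong)
  also have "\<dots> = dj_U n f $$ (r, bits_to_nat (x @ [w]))"
    using \<open>bits_to_nat (x @ [w]) < _\<close> by simp
  also have "\<dots> = basis_ket (x @ [w \<noteq> f x]) $$ (r, c)"
    using * assms by (simp add: dj_U_index basis_ket_index)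
  finally show "(dj_U n f * basis_ket (x @ [w])) $$ (r, c) = basis_ket (x @ [w \<noteq> f x]) $$ (r, c)" .
qed (use assms in \<open>auto simp: dj_U_def\<close>)

end

theory Submission
  imports Defs
begin

text \<open>
  Conjugating \<open>U_f\<close> by Hadamard gates preserves the work bit \<open>b\<close> and sends the input basis state
  \<open>x\<close> to \<open>y\<close> with an amplitude that depends only on \<open>x \<oplus> y\<close>: it is the normalised Walsh-Fourier
  coefficient, at \<open>x \<oplus> y\<close>, of \<open>(-1) ^ (b f)\<close>. Hence the output distribution of the input qubits is
  the distribution of \<open>x\<close> convolved over \<open>(\<int>/2)^n\<close> with the squared spectrum, and since \<open>(-1) ^ y_i\<close>
  is a character, every \<open>E_i\<close> factors as \<open>(2 p_i - 1)\<close> times the mean of the character under the squared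
  spectrum. For \<open>b = 0\<close> or constant \<open>f\<close> the spectrum is concentrated at \<open>0\<close>. If \<open>f\<close> is balanced, the
  coefficient at \<open>0\<close> vanishes, so by Parseval the means add up to at most \<open>n - 2\<close>.
\<close>

section \<open>Matrix entries indexed by bit strings\<close>

definition entry :: "complex mat \<Rightarrow> bool list \<Rightarrow> bool list \<Rightarrow> complex" where
  "entry A x y = A $$ (bits_to_nat x, bits_to_nat y)"

lemma finite_bitstrings [simp]: "finite (bitstrings n)"
  using finite_lists_length_eq[of "UNIV :: bool set" n] by (simp add: bitstrings_def)

lemma card_bitstrings: "card (bitstrings n) = 2 ^ n"
  using card_lists_length_eq[of "UNIV :: bool set" n] by (simp add: bitstrings_def)

text \<open>An injection between finite sets of equal size is a bijection. It turns sums over matrix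
  indices into sums over bit strings, so that products and traces can be computed bitwise.\<close>

lemma bij_betw_bits_to_nat: "bij_betw bits_to_nat (bitstrings m) {..<2 ^ m}"
proof -
  have inj: "inj_on bits_to_nat (bitstrings m)"
    by (auto simp: inj_on_def bitstrings_def bits_to_nat_inj)
  moreover have "bits_to_nat ` bitstrings m \<subseteq> {..<2 ^ m}"
    using bits_to_nat_less by (auto simp: bitstrings_def)
  ultimately have "bits_to_nat ` bitstrings m = {..<2 ^ m}"
    by (intro card_subset_eq) (auto simp: card_image card_bitstrings)
  with inj show ?thesis by (simp add: bij_betw_def)
qed

text \<open>Strings are split at the end because the work qubit is the last tensor factor.\<close>

lemma sum_bitstrings_snoc:
  "(\<Sum>x\<in>bitstrings (Suc n). g x) = (\<Sum>x\<in>bitstrings n. g (x @ [False]) + g (x @ [True]))"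
proof -
  have inj: "inj_on (\<lambda>(x, b). x @ [b]) (bitstrings n \<times> (UNIV :: bool set))"
    by (auto simp: inj_on_def)
  have img: "bitstrings (Suc n) = (\<lambda>(x, b). x @ [b]) ` (bitstrings n \<times> UNIV)"
  proof (intro equalityI subsetI)
    fix x assume "x \<in> bitstrings (Suc n)"
    then show "x \<in> (\<lambda>(x, b). x @ [b]) ` (bitstrings n \<times> UNIV)"
      by (cases x rule: rev_cases) (auto simp: bitstrings_def)
  qed (auto simp: bitstrings_def)
  have "(\<Sum>x\<in>bitstrings (Suc n). g x) = (\<Sum>(x, b)\<in>bitstrings n \<times> UNIV. g (x @ [b]))"
    unfolding img sum.reindex[OF inj] by (simp add: case_prod_unfold)
  also have "\<dots> = (\<Sum>x\<in>bitstrings n. g (x @ [False]) + g (x @ [True]))"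
    by (simp add: UNIV_bool flip: sum.cartesian_product)
  finally show ?thesis .
qed

text \<open>The distributive law on the cube: it gives both the orthogonality of characters and the
  means over product inputs.\<close>

lemma sum_prod_bitstrings:
  fixes g :: "nat \<Rightarrow> bool \<Rightarrow> 'a :: comm_semiring_1"
  shows "(\<Sum>x\<in>bitstrings n. \<Prod>j<n. g j (x ! j)) = (\<Prod>j<n. g j False + g j True)"
proof (induction n)
  case 0
  then show ?case by (simp add: bitstrings_def)
next
  case (Suc n)
  have "(\<Sum>x\<in>bitstrings (Suc n). \<Prod>j<Suc n. g j (x ! j))
      = (\<Sum>x\<in>bitstrings n. (\<Prod>j<n. g j (x ! j)) * (g n False + g n True))"
    unfolding sum_bitstrings_snoc
    by (intro sum.cong refl) (auto simp: bitstrings_def nth_append distrib_left)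
  also have "\<dots> = (\<Prod>j<n. g j False + g j True) * (g n False + g n True)"
    by (simp add: Suc.IH flip: sum_distrib_right)
  finally show ?case by simp
qed

lemma entry_mult:
  assumes "A \<in> carrier_mat (2 ^ m) (2 ^ m)" "B \<in> carrier_mat (2 ^ m) (2 ^ m)"
    and "x \<in> bitstrings m" "y \<in> bitstrings m"
  shows "entry (A * B) x y = (\<Sum>z\<in>bitstrings m. entry A x z * entry B z y)"
proof -
  have "bits_to_nat x < 2 ^ m" "bits_to_nat y < 2 ^ m"
    using assms bits_to_nat_less[of x] bits_to_nat_less[of y] by (auto simp: bitstrings_def)
  then have "entry (A * B) x y = (\<Sum>k<2 ^ m. A $$ (bits_to_nat x, k) * B $$ (k, bits_to_nat y))"
    using assms by (simp add: entry_def scalar_prod_def atLeast0LessThan)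
  also have "\<dots> = (\<Sum>z\<in>bitstrings m. entry A x z * entry B z y)"
    unfolding entry_def by (rule sum.reindex_bij_betw[OF bij_betw_bits_to_nat, symmetric])
  finally show ?thesis .
qed

lemma entry_adjoint:
  assumes "A \<in> carrier_mat (2 ^ m) (2 ^ m)" "x \<in> bitstrings m" "y \<in> bitstrings m"
  shows "entry (mat_adjoint A) x y = cnj (entry A y x)"
proof -
  have "bits_to_nat x < 2 ^ m" "bits_to_nat y < 2 ^ m"
    using assms bits_to_nat_less[of x] bits_to_nat_less[of y] by (auto simp: bitstrings_def)
  then show ?thesis
    using assms(1) by (simp add: entry_def mat_adjoint_def mat_of_rows_index)
qed

lemma mat_trace_eq_sum_entry:
  assumes "A \<in> carrier_mat (2 ^ m) (2 ^ m)"
  shows "mat_trace A = (\<Sum>x\<in>bitstrings m. entry A x x)"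
  using sum.reindex_bij_betw[OF bij_betw_bits_to_nat, of "\<lambda>k. A $$ (k, k)" m] assms
  by (simp add: mat_trace_def entry_def)

lemma tensor_carrier:
  assumes "\<forall>A\<in>set As. A \<in> carrier_mat 2 2"
  shows "tensor As \<in> carrier_mat (2 ^ length As) (2 ^ length As)"
  using assms by (induction As) (auto simp: kron_def)

text \<open>The first factor carries the most significant bit, so division and remainder by
  \<open>2 ^ length As\<close> in \<open>kron\<close> separate the head of a bit string from its
  tail.\<close>

lemma entry_tensor:
  assumes "\<forall>A\<in>set As. A \<in> carrier_mat 2 2" "x \<in> bitstrings (length As)" "y \<in> bitstrings (length As)"
  shows "entry (tensor As) x y = (\<Prod>j<length As. (As ! j) $$ (of_bool (x ! j), of_bool (y ! j)))"
  using assms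
proof (induction As arbitrary: x y)
  case Nil
  then show ?case by (simp add: entry_def bitstrings_def)
next
  case (Cons A As)
  obtain a x' b y' where xy: "x = a # x'" "y = b # y'"
    and len: "length x' = length As" "length y' = length As"
    using Cons.prems by (cases x; cases y) (auto simp: bitstrings_def)
  have T: "tensor As \<in> carrier_mat (2 ^ length As) (2 ^ length As)"
    using Cons.prems by (intro tensor_carrier) auto
  have A: "A \<in> carrier_mat 2 2" using Cons.prems by auto
  have lt: "bits_to_nat x' < 2 ^ length As" "bits_to_nat y' < 2 ^ length As"
    using bits_to_nat_less[of x'] bits_to_nat_less[of y'] len by auto
  have "bits_to_nat x < 2 * 2 ^ length As" "bits_to_nat y < 2 * 2 ^ length As"
    using bits_to_nat_less[of x] bits_to_nat_less[of y] len xy by auto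
  then have "entry (tensor (A # As)) x y = A $$ (of_bool a, of_bool b) * entry (tensor As) x' y'"
    using T A lt xy len by (simp add: entry_def kron_def)
  also have "entry (tensor As) x' y' = (\<Prod>j<length As. (As ! j) $$ (of_bool (x' ! j), of_bool (y' ! j)))"
    using Cons len by (intro Cons.IH) (auto simp: bitstrings_def)
  finally show ?case by (simp add: xy prod.lessThan_Suc_shift del: prod.lessThan_Suc)
qed

lemma entry_dj_U:
  assumes "r \<in> bitstrings (Suc n)" "z \<in> bitstrings n"
  shows "entry (dj_U n f) r (z @ [w]) = of_bool (r = z @ [w \<noteq> f z])"
  using assms bits_to_nat_less[of r] bits_to_nat_inj[of r "z @ [w \<noteq> f z]"]
    dj_U_index[of "bits_to_nat r" n z f w]
  by (auto simp: entry_def bitstrings_def)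

section \<open>Signs, characters and bitwise addition on (Z/2)^n\<close>

definition bsign :: "bool \<Rightarrow> real" where
  "bsign b = (if b then -1 else 1)"

lemma bsign_simps [simp]: "bsign False = 1" "bsign True = -1"
  by (simp_all add: bsign_def)

lemma bsign_neq: "bsign (a \<noteq> b) = bsign a * bsign b"
  by (simp add: bsign_def)

text \<open>The character (-1)^(x . y), written as a product of signs instead of through a parity so
  that \<open>sum_prod_bitstrings\<close> applies directly.\<close>

definition walsh :: "bool list \<Rightarrow> bool list \<Rightarrow> real" where
  "walsh x y = (\<Prod>j<length x. bsign (x ! j \<and> y ! j))"

definition bxor :: "bool list \<Rightarrow> bool list \<Rightarrow> bool list" where
  "bxor x y = map2 (\<noteq>) x y"

lemma bxor_bitstrings [simp]:
  "x \<in> bitstrings n \<Longrightarrow> y \<in> bitstrings n \<Longrightarrow> bxor x y \<in> bitstrings n"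
  by (simp add: bxor_def bitstrings_def)

lemma nth_bxor:
  "x \<in> bitstrings n \<Longrightarrow> y \<in> bitstrings n \<Longrightarrow> j < n \<Longrightarrow> bxor x y ! j = (x ! j \<noteq> y ! j)"
  by (simp add: bxor_def bitstrings_def)

lemma bitstrings_eqI:
  "x \<in> bitstrings n \<Longrightarrow> y \<in> bitstrings n \<Longrightarrow> (\<And>j. j < n \<Longrightarrow> x ! j = y ! j) \<Longrightarrow> x = y"
  by (simp add: bitstrings_def list_eq_iff_nth_eq)

lemma bxor_bxor_cancel:
  assumes "x \<in> bitstrings n" "y \<in> bitstrings n"
  shows "bxor x (bxor x y) = y"
  by (rule bitstrings_eqI[of _ n]) (use assms in \<open>auto simp: nth_bxor[where n = n]\<close>)

text \<open>Translation by \<open>x\<close> is its own inverse. This permits replacing an output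
  \<open>y\<close> by its difference from the input \<open>x\<close> as summation variable.\<close>

lemma bij_betw_bxor:
  assumes "x \<in> bitstrings n"
  shows "bij_betw (bxor x) (bitstrings n) (bitstrings n)"
  by (rule bij_betw_byWitness[where f' = "bxor x"])
    (use assms in \<open>auto simp: bxor_bxor_cancel[where n = n]\<close>)

lemma walsh_bxor:
  assumes "x \<in> bitstrings n" "y \<in> bitstrings n" "z \<in> bitstrings n"
  shows "walsh z (bxor x y) = walsh z x * walsh z y"
proof -
  have "length z = n" using assms by (simp add: bitstrings_def)
  then show ?thesis
    unfolding walsh_def prod.distrib[symmetric]
    by (intro prod.cong) (auto simp: nth_bxor[OF assms(1,2)] bsign_def)
qed

lemma walsh_commute: "x \<in> bitstrings n \<Longrightarrow> y \<in> bitstrings n \<Longrightarrow> walsh x y = walsh y x"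
  by (simp add: walsh_def bitstrings_def conj_commute)

text \<open>Orthogonality of characters: the sum factors over positions, and every set bit of
  \<open>s\<close> contributes the factor 1 + (-1) = 0.\<close>

lemma sum_walsh:
  assumes "s \<in> bitstrings n"
  shows "(\<Sum>z\<in>bitstrings n. walsh z s) = 2 ^ n * of_bool (s = replicate n False)"
proof -
  have "(\<Sum>z\<in>bitstrings n. walsh z s) = (\<Sum>z\<in>bitstrings n. \<Prod>j<n. bsign (z ! j \<and> s ! j))"
    by (intro sum.cong) (auto simp: walsh_def bitstrings_def)
  also have "\<dots> = (\<Prod>j<n. 1 + bsign (s ! j))"
    using sum_prod_bitstrings[where g = "\<lambda>j b. bsign (b \<and> s ! j)"] by simp
  also have "\<dots> = 2 ^ n * of_bool (s = replicate n False)"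
  proof (cases "s = replicate n False")
    case False
    then obtain j where "j < n" "s ! j"
      using assms by (auto simp: bitstrings_def list_eq_iff_nth_eq)
    then have "(\<Prod>j<n. 1 + bsign (s ! j)) = 0"
      by (intro prod_zero) (auto intro!: bexI[of _ j])
    with False show ?thesis by simp
  qed simp
  finally show ?thesis .
qed

section \<open>Walsh-Fourier coefficients and Parseval's identity\<close>

definition fourier :: "nat \<Rightarrow> (bool list \<Rightarrow> bool) \<Rightarrow> bool list \<Rightarrow> real" where
  "fourier n g s = (\<Sum>z\<in>bitstrings n. walsh z s * bsign (g z)) / 2 ^ n"

lemma bxor_eq_zero_iff:
  assumes "x \<in> bitstrings n" "y \<in> bitstrings n"
  shows "bxor x y = replicate n False \<longleftrightarrow> x = y"
  using assms by (auto simp: bxor_def bitstrings_def list_eq_iff_nth_eq)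

text \<open>Expanding the square, the two characters merge into one at \<open>bxor z z'\<close>.
  Summing over \<open>s\<close> leaves only the diagonal \<open>z = z'\<close>, where the signs
  square to 1. The factor \<open>2 ^ n\<close> clears the normalisation meanwhile.\<close>

lemma parseval: "(\<Sum>s\<in>bitstrings n. (fourier n g s)\<^sup>2) = 1"
proof -
  have "(\<Sum>s\<in>bitstrings n. (2 ^ n * fourier n g s)\<^sup>2)
      = (\<Sum>s\<in>bitstrings n. \<Sum>z\<in>bitstrings n. \<Sum>z'\<in>bitstrings n.
           (bsign (g z) * bsign (g z')) * walsh s (bxor z z'))"
  proof (rule sum.cong, rule refl)
    fix s assume s: "s \<in> bitstrings n"
    have "(2 ^ n * fourier n g s)\<^sup>2 = (\<Sum>z\<in>bitstrings n. \<Sum>z'\<in>bitstrings n.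
        (walsh z s * bsign (g z)) * (walsh z' s * bsign (g z')))"
      by (simp add: fourier_def power2_eq_square sum_product)
    also have "\<dots> = (\<Sum>z\<in>bitstrings n. \<Sum>z'\<in>bitstrings n.
        (bsign (g z) * bsign (g z')) * walsh s (bxor z z'))"
      using s by (intro sum.cong refl) (simp add: walsh_bxor walsh_commute[of s n])
    finally show "(2 ^ n * fourier n g s)\<^sup>2 = (\<Sum>z\<in>bitstrings n. \<Sum>z'\<in>bitstrings n.
        (bsign (g z) * bsign (g z')) * walsh s (bxor z z'))" .
  qed
  also have "\<dots> = (\<Sum>z\<in>bitstrings n. \<Sum>z'\<in>bitstrings n. \<Sum>s\<in>bitstrings n.
           (bsign (g z) * bsign (g z')) * walsh s (bxor z z'))"
    \<comment> \<open>Two interchanges make the sum over \<open>s\<close> innermost, where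
      orthogonality applies.\<close>
    by (subst sum.swap, rule sum.cong, rule refl, rule sum.swap)
  also have "\<dots> = (\<Sum>z\<in>bitstrings n. \<Sum>z'\<in>bitstrings n. if z = z' then 2 ^ n else 0)"
    by (intro sum.cong refl)
      (simp add: sum_walsh bxor_eq_zero_iff bsign_def flip: sum_distrib_left)
  also have "\<dots> = 2 ^ n * 2 ^ n"
    by (simp add: card_bitstrings)
  finally show ?thesis
    by (simp add: power_mult_distrib flip: sum_distrib_left) (simp add: power2_eq_square)
qed

text \<open>The constant sign factors out and leaves a plain character sum. This serves a constant
  \<open>f\<close> and also the work bit 0, for which the phase function is identically
  \<open>False\<close>.\<close>

lemma fourier_const:
  assumes "\<And>z. z \<in> bitstrings n \<Longrightarrow> g z = c" "s \<in> bitstrings n"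
  shows "fourier n g s = bsign c * of_bool (s = replicate n False)"
proof -
  have "(\<Sum>z\<in>bitstrings n. walsh z s * bsign (g z)) = (\<Sum>z\<in>bitstrings n. walsh z s) * bsign c"
    using assms(1) by (simp add: sum_distrib_right)
  then show ?thesis using sum_walsh[OF assms(2)] by (simp add: fourier_def)
qed

text \<open>The character at the zero string is trivial, so this coefficient is the normalised
  difference between the numbers of zeros and ones of \<open>f\<close>.\<close>

lemma fourier_balanced:
  assumes "balanced_fun n f"
  shows "fourier n f (replicate n False) = 0"
proof -
  have "(\<Sum>z\<in>bitstrings n. walsh z (replicate n False) * bsign (f z))
      = (\<Sum>z\<in>bitstrings n. of_bool (\<not> f z) - of_bool (f z))"
    by (intro sum.cong) (auto simp: walsh_def bitstrings_def bsign_def intro!: prod.neutral)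
  also have "\<dots> = real (card {z \<in> bitstrings n. \<not> f z}) - real (card {z \<in> bitstrings n. f z})"
    by (simp add: sum_subtractf Int_def flip: Collect_conj_eq)
  finally show ?thesis using assms by (simp add: fourier_def balanced_fun_def)
qed

section \<open>Entries of the single-qubit gates and states\<close>

lemma hadamard_carrier [simp]: "hadamard \<in> carrier_mat 2 2"
  by (auto simp: hadamard_def mat_of_rows_list_def)

lemma hadamard_entry:
  "hadamard $$ (of_bool a, of_bool b) = complex_of_real (bsign (a \<and> b) / sqrt 2)"
  by (cases a; cases b) (auto simp: hadamard_def mat_of_rows_list_def)

lemma pauli_Z_carrier [simp]: "pauli_Z \<in> carrier_mat 2 2"
  by (auto simp: pauli_Z_def mat_of_rows_list_def)

lemma pauli_Z_entry:
  "pauli_Z $$ (of_bool a, of_bool b) = complex_of_real (of_bool (a = b) * bsign a)"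
  by (cases a; cases b) (auto simp: pauli_Z_def mat_of_rows_list_def)

lemma proj_carrier [simp]: "proj c \<in> carrier_mat 2 2"
  by (auto simp: proj_def mat_adjoint_def intro!: carrier_matI)

lemma proj_entry:
  "proj c $$ (of_bool a, of_bool b) = of_bool (a = c \<and> b = c)"
proof -
  have "(of_bool a :: nat) < 2" "(of_bool b :: nat) < 2" by auto
  then show ?thesis
    by (auto simp: proj_def mat_adjoint_def scalar_prod_def mat_of_rows_index ket_index)
qed

lemma qubit_mix_carrier [simp]: "qubit_mix p \<in> carrier_mat 2 2"
  by (auto simp: qubit_mix_def)

lemma qubit_mix_entry:
  "qubit_mix p $$ (of_bool a, of_bool b) = complex_of_real (of_bool (a = b) * (if a then 1 - p else p))"
proof -
  have "(of_bool a :: nat) < 2" "(of_bool b :: nat) < 2" by auto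
  moreover have "dim_row (proj c) = 2" "dim_col (proj c) = 2" for c
    using proj_carrier[of c] by (auto dest: carrier_matD simp del: proj_carrier)
  ultimately show ?thesis
    by (auto simp: qubit_mix_def proj_entry)
qed

text \<open>Pure basis states become mixtures, so a single formula for mixed inputs covers the pure
  input of part (a) too.\<close>

lemma qubit_mix_0_1: "qubit_mix 1 = proj False" "qubit_mix 0 = proj True"
proof -
  have "dim_row (proj c) = 2" "dim_col (proj c) = 2" for c
    using proj_carrier[of c] by (auto dest: carrier_matD simp del: proj_carrier)
  then show "qubit_mix 1 = proj False" "qubit_mix 0 = proj True"
    by (auto simp: qubit_mix_def intro!: eq_matI)
qed

text \<open>The parameter of \<open>qubit_mix\<close> is the weight of |0>, which for the work qubit
  of part (b) is \<open>1 - p\<close>.\<close>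

lemma qubit_mix_flip:
  "complex_of_real p \<cdot>\<^sub>m proj True + complex_of_real (1 - p) \<cdot>\<^sub>m proj False = qubit_mix (1 - p)"
proof -
  have "dim_row (proj c) = 2" "dim_col (proj c) = 2" for c
    using proj_carrier[of c] by (auto dest: carrier_matD simp del: proj_carrier)
  then show ?thesis
    by (auto simp: qubit_mix_def intro!: eq_matI)
qed


section \<open>The circuit in the computational basis and its measurement\<close>

lemma walsh_snoc:
  "x \<in> bitstrings n \<Longrightarrow> y \<in> bitstrings n \<Longrightarrow>
    walsh (x @ [a]) (y @ [b]) = walsh x y * bsign (a \<and> b)"
  by (simp add: walsh_def bitstrings_def nth_append)

lemma snoc_bitstrings [simp]: "x @ [b] \<in> bitstrings (Suc n) \<longleftrightarrow> x \<in> bitstrings n"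
  by (simp add: bitstrings_def)

lemma hadamard_tensor_carrier [simp]:
  "tensor (replicate m hadamard) \<in> carrier_mat (2 ^ m) (2 ^ m)"
  using tensor_carrier[of "replicate m hadamard"] by simp

lemma entry_hadamard_tensor:
  assumes "x \<in> bitstrings m" "y \<in> bitstrings m"
  shows "entry (tensor (replicate m hadamard)) x y = complex_of_real (walsh x y / sqrt 2 ^ m)"
proof -
  have "entry (tensor (replicate m hadamard)) x y
      = (\<Prod>j<m. complex_of_real (bsign (x ! j \<and> y ! j) / sqrt 2))"
    using entry_tensor[of "replicate m hadamard" x y] assms by (simp add: hadamard_entry)
  also have "\<dots> = complex_of_real (walsh x y / sqrt 2 ^ m)"
    using assms by (simp add: walsh_def bitstrings_def prod_dividef)
  finally show ?thesis .
qed

lemma dj_U_carrier [simp]: "dj_U n f \<in> carrier_mat (2 ^ Suc n) (2 ^ Suc n)"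
  by (simp add: dj_U_def)

lemma dj_circuit_carrier [simp]: "dj_circuit n f \<in> carrier_mat (2 ^ Suc n) (2 ^ Suc n)"
  unfolding dj_circuit_def Suc_eq_plus1[symmetric]
  by (intro mult_carrier_mat[of _ _ "2 ^ Suc n"] hadamard_tensor_carrier dj_U_carrier)

text \<open>Phase kickback: an intermediate state (z, w) contributes the sign (-1)^(b (w + f z) + w
  a). Its sum over w is (-1)^(b f z) (1 + (-1)^(a + b)), which forces \<open>a = b\<close>. The
  characters at \<open>x\<close> and \<open>y\<close> merge into the one at
  \<open>bxor x y\<close>.\<close>

lemma entry_dj_circuit:
  assumes "x \<in> bitstrings n" "y \<in> bitstrings n"
  shows "entry (dj_circuit n f) (y @ [b]) (x @ [a])
      = complex_of_real (of_bool (a = b) * fourier n (\<lambda>z. b \<and> f z) (bxor x y))"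
proof -
  let ?H = "tensor (replicate (Suc n) hadamard)"
  let ?h = "\<lambda>x y. complex_of_real (walsh x y / sqrt 2 ^ Suc n)"
  \<comment> \<open>\<open>dj_U\<close> permutes basis states, so a single row survives in the
    matrix product.\<close>
  have HU: "entry (?H * dj_U n f) (y @ [b]) (z @ [w]) = ?h (y @ [b]) (z @ [w \<noteq> f z])"
    if z: "z \<in> bitstrings n" for z w
  proof -
    have "entry (?H * dj_U n f) (y @ [b]) (z @ [w])
        = (\<Sum>r\<in>bitstrings (Suc n). ?h (y @ [b]) r * of_bool (r = z @ [w \<noteq> f z]))"
      using assms z
      by (subst entry_mult[OF hadamard_tensor_carrier dj_U_carrier])
        (auto simp: entry_hadamard_tensor entry_dj_U
          simp del: replicate_Suc append1_eq_conv intro!: sum.cong)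
    also have "\<dots> = ?h (y @ [b]) (z @ [w \<noteq> f z])"
      using z by (simp add: of_bool_def if_distrib[of "\<lambda>t. _ * t"] cong: if_cong)
    finally show ?thesis .
  qed
  \<comment> \<open>The joint normalisation of the two Hadamard layers. The extra factor 2 is
    absorbed below by the sum over the two work bits.\<close>
  have sq: "sqrt 2 ^ Suc n * sqrt 2 ^ Suc n = 2 * 2 ^ n"
    using power_mult_distrib[of "sqrt 2" "sqrt 2" "Suc n"] by simp
  have HUc: "?H * dj_U n f \<in> carrier_mat (2 ^ Suc n) (2 ^ Suc n)"
    by (intro mult_carrier_mat[of _ _ "2 ^ Suc n"] hadamard_tensor_carrier dj_U_carrier)
  have "entry (dj_circuit n f) (y @ [b]) (x @ [a])
      = (\<Sum>v\<in>bitstrings (Suc n). entry (?H * dj_U n f) (y @ [b]) v * entry ?H v (x @ [a]))"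
    unfolding dj_circuit_def Suc_eq_plus1[symmetric]
    by (rule entry_mult[OF HUc hadamard_tensor_carrier]) (use assms in simp_all)
  also have "\<dots> = (\<Sum>z\<in>bitstrings n.
      complex_of_real (of_bool (a = b) * (walsh z (bxor x y) * bsign (b \<and> f z)) / 2 ^ n))"
    unfolding sum_bitstrings_snoc
  proof (rule sum.cong, rule refl)
    fix z assume z: "z \<in> bitstrings n"
    have summand: "entry (?H * dj_U n f) (y @ [b]) (z @ [w]) * entry ?H (z @ [w]) (x @ [a])
        = complex_of_real (walsh z (bxor x y) * (bsign (b \<and> (w \<noteq> f z)) * bsign (w \<and> a)) / (2 * 2 ^ n))" for w
    proof -
      have "entry (?H * dj_U n f) (y @ [b]) (z @ [w]) * entry ?H (z @ [w]) (x @ [a])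
          = ?h (y @ [b]) (z @ [w \<noteq> f z]) * ?h (z @ [w]) (x @ [a])"
        using assms z by (simp add: HU entry_hadamard_tensor del: replicate_Suc)
      also have "\<dots> = complex_of_real (walsh z (bxor x y) * (bsign (b \<and> (w \<noteq> f z)) * bsign (w \<and> a)) / (2 * 2 ^ n))"
        unfolding sq[symmetric]
        using assms z
        by (simp add: walsh_snoc[where n = n] walsh_bxor[where n = n] walsh_commute[of y n z])
      finally show ?thesis .
    qed
    \<comment> \<open>The contributions of the two intermediate work bits agree when
      \<open>a = b\<close> and cancel otherwise.\<close>
    show "entry (?H * dj_U n f) (y @ [b]) (z @ [False]) * entry ?H (z @ [False]) (x @ [a])
        + entry (?H * dj_U n f) (y @ [b]) (z @ [True]) * entry ?H (z @ [True]) (x @ [a])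
        = complex_of_real (of_bool (a = b) * (walsh z (bxor x y) * bsign (b \<and> f z)) / 2 ^ n)"
      unfolding summand by (cases a; cases b; cases "f z") simp_all
  qed
  also have "\<dots> = complex_of_real (of_bool (a = b) * fourier n (\<lambda>z. b \<and> f z) (bxor x y))"
    by (simp add: fourier_def flip: sum_divide_distrib)
  finally show ?thesis .
qed

text \<open>For a diagonal input and a diagonal observable only squared moduli of amplitudes matter,
  so the expectation becomes classical: weight \<open>d x\<close>, transition weight |V_yx|^2, value
  \<open>e y\<close>.\<close>

lemma mat_trace_conjugate_diagonal:
  fixes d e :: "bool list \<Rightarrow> real"
  assumes V: "V \<in> carrier_mat (2 ^ m) (2 ^ m)"
    and D: "D \<in> carrier_mat (2 ^ m) (2 ^ m)" and E: "E \<in> carrier_mat (2 ^ m) (2 ^ m)"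
    and d: "\<And>x y. x \<in> bitstrings m \<Longrightarrow> y \<in> bitstrings m \<Longrightarrow> entry D x y = of_bool (x = y) * complex_of_real (d x)"
    and e: "\<And>x y. x \<in> bitstrings m \<Longrightarrow> y \<in> bitstrings m \<Longrightarrow> entry E x y = of_bool (x = y) * complex_of_real (e x)"
  shows "mat_trace (V * D * mat_adjoint V * E)
      = (\<Sum>y\<in>bitstrings m. \<Sum>x\<in>bitstrings m. (cmod (entry V y x))\<^sup>2 * d x * e y)"
proof -
  have delta: "(\<Sum>z\<in>bitstrings m. g z * (of_bool (z = y) * h z)) = g y * h y"
    if "y \<in> bitstrings m" for g h :: "bool list \<Rightarrow> complex" and y
    using that by (simp add: of_bool_def if_distrib[of "\<lambda>t. _ * t"] if_distrib[of "\<lambda>t. t * _"] cong: if_cong)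
  have adj: "mat_adjoint V \<in> carrier_mat (2 ^ m) (2 ^ m)"
    using V by (auto simp: mat_adjoint_def intro!: carrier_matI)
  have VD: "V * D \<in> carrier_mat (2 ^ m) (2 ^ m)" and VDV: "V * D * mat_adjoint V \<in> carrier_mat (2 ^ m) (2 ^ m)"
    using V D adj by (auto intro!: mult_carrier_mat[of _ _ "2 ^ m"])
  have eVD: "entry (V * D) y x = entry V y x * d x" if "x \<in> bitstrings m" "y \<in> bitstrings m" for x y
    using that by (simp add: entry_mult[OF V D] d delta cong: sum.cong)
  have eVDV: "entry (V * D * mat_adjoint V) y y = (\<Sum>x\<in>bitstrings m. (cmod (entry V y x))\<^sup>2 * d x)"
    if "y \<in> bitstrings m" for y
  proof -
    have "entry (V * D * mat_adjoint V) y y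
        = (\<Sum>x\<in>bitstrings m. (entry V y x * cnj (entry V y x)) * d x)"
      using that by (simp add: entry_mult[OF VD adj] eVD entry_adjoint[OF V] mult_ac cong: sum.cong)
    then show ?thesis by (simp only: complex_norm_square of_real_mult of_real_sum)
  qed
  have "mat_trace (V * D * mat_adjoint V * E)
      = (\<Sum>y\<in>bitstrings m. entry (V * D * mat_adjoint V) y y * e y)"
    using VDV E
    by (subst mat_trace_eq_sum_entry[of _ m])
      (auto simp: entry_mult[OF VDV E] e delta intro!: sum.cong mult_carrier_mat[of _ _ "2 ^ m"])
  also have "\<dots> = (\<Sum>y\<in>bitstrings m. \<Sum>x\<in>bitstrings m. (cmod (entry V y x))\<^sup>2 * d x * e y)"
    by (simp add: eVDV sum_distrib_right)
  finally show ?thesis .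
qed

text \<open>A tensor product of diagonal matrices is diagonal, since one differing bit makes the
  whole product vanish.\<close>

lemma prod_of_bool_nth_eq:
  fixes g :: "nat \<Rightarrow> 'a :: comm_semiring_1"
  assumes "x \<in> bitstrings m" "y \<in> bitstrings m"
  shows "(\<Prod>j<m. of_bool (x ! j = y ! j) * g j) = of_bool (x = y) * (\<Prod>j<m. g j)"
proof (cases "x = y")
  case False
  then obtain j where "j < m" "x ! j \<noteq> y ! j"
    using assms bitstrings_eqI by blast
  then have "(\<Prod>j<m. of_bool (x ! j = y ! j) * g j) = 0"
    by (intro prod_zero) (auto intro!: bexI[of _ j])
  with False show ?thesis by simp
qed simp

section \<open>Product inputs and observables as diagonal matrices\<close>

definition mix_weight :: "real \<Rightarrow> bool \<Rightarrow> real" where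
  "mix_weight p b = (if b then 1 - p else p)"

lemma mix_weight_simps [simp]: "mix_weight p False = p" "mix_weight p True = 1 - p"
  by (simp_all add: mix_weight_def)

lemma dj_input_carrier:
  assumes "\<And>j. \<sigma> j \<in> carrier_mat 2 2" "\<omega> \<in> carrier_mat 2 2"
  shows "dj_input n \<sigma> \<omega> \<in> carrier_mat (2 ^ Suc n) (2 ^ Suc n)"
  using tensor_carrier[of "map \<sigma> [1..<n + 1] @ [\<omega>]"] assms by (auto simp: dj_input_def)

lemma entry_dj_input:
  assumes "x \<in> bitstrings (Suc n)" "y \<in> bitstrings (Suc n)"
  shows "entry (dj_input n (\<lambda>j. qubit_mix (p j)) (qubit_mix r)) x y
      = of_bool (x = y) * complex_of_real ((\<Prod>j<n. mix_weight (p (Suc j)) (x ! j)) * mix_weight r (x ! n))"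
proof -
  let ?As = "map (\<lambda>j. qubit_mix (p j)) [1..<n + 1] @ [qubit_mix r]"
  \<comment> \<open>Qubits are numbered from 1 and list positions from 0: position
    \<open>j < n\<close> holds input qubit \<open>Suc j\<close>, and position \<open>n\<close> the
    work qubit.\<close>
  let ?q = "\<lambda>j. if j < n then p (Suc j) else r"
  have "entry (dj_input n (\<lambda>j. qubit_mix (p j)) (qubit_mix r)) x y
      = (\<Prod>j<Suc n. (?As ! j) $$ (of_bool (x ! j), of_bool (y ! j)))"
    unfolding dj_input_def using assms entry_tensor[of ?As x y] by (simp del: upt_Suc)
  also have "\<dots> = (\<Prod>j<Suc n. of_bool (x ! j = y ! j) * complex_of_real (mix_weight (?q j) (x ! j)))"
  proof (rule prod.cong, rule refl)
    fix j assume "j \<in> {..<Suc n}"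
    moreover have "[1..<n + 1] ! j = Suc j" if "j < n"
      using that by (subst nth_upt) auto
    ultimately have "?As ! j = qubit_mix (?q j)"
      by (cases "j < n") (auto simp: nth_append less_Suc_eq simp del: upt_Suc)
    then show "(?As ! j) $$ (of_bool (x ! j), of_bool (y ! j))
        = of_bool (x ! j = y ! j) * complex_of_real (mix_weight (?q j) (x ! j))"
      by (simp add: qubit_mix_entry mix_weight_def)
  qed
  also have "\<dots> = of_bool (x = y) * (\<Prod>j<Suc n. complex_of_real (mix_weight (?q j) (x ! j)))"
    by (rule prod_of_bool_nth_eq[OF assms])
  finally show ?thesis by simp
qed

lemma Z_on_carrier: "Z_on n i \<in> carrier_mat (2 ^ Suc n) (2 ^ Suc n)"
proof -
  let ?As = "map (\<lambda>j. if j = i then pauli_Z else 1\<^sub>m 2) [1..<n + 2]"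
  have "tensor ?As \<in> carrier_mat (2 ^ length ?As) (2 ^ length ?As)"
    by (rule tensor_carrier) (auto simp del: upt_Suc)
  then show ?thesis by (simp add: Z_on_def del: upt_Suc)
qed

lemma entry_Z_on:
  assumes "x \<in> bitstrings (Suc n)" "y \<in> bitstrings (Suc n)" "k < n"
  shows "entry (Z_on n (Suc k)) x y = of_bool (x = y) * complex_of_real (bsign (x ! k))"
proof -
  let ?As = "map (\<lambda>j. if j = Suc k then pauli_Z else 1\<^sub>m 2) [1..<n + 2]"
  have one: "1\<^sub>m 2 $$ (of_bool a, of_bool b) = (of_bool (a = b) :: complex)" for a b
    by (cases a; cases b) auto
  have "entry (Z_on n (Suc k)) x y = (\<Prod>j<Suc n. (?As ! j) $$ (of_bool (x ! j), of_bool (y ! j)))"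
    unfolding Z_on_def using assms entry_tensor[of ?As x y] by (simp del: upt_Suc)
  also have "\<dots> = (\<Prod>j<Suc n. of_bool (x ! j = y ! j)
      * (if j = k then complex_of_real (bsign (x ! j)) else 1))"
    by (rule prod.cong) (auto simp: one pauli_Z_entry simp del: upt_Suc)
  also have "\<dots> = of_bool (x = y) * (\<Prod>j<Suc n. if j = k then complex_of_real (bsign (x ! j)) else 1)"
    by (rule prod_of_bool_nth_eq[OF assms(1,2)])
  also have "(\<Prod>j<Suc n. if j = k then complex_of_real (bsign (x ! j)) else 1) = complex_of_real (bsign (x ! k))"
    using assms(3) by (subst prod.delta) auto
  finally show ?thesis .
qed

section \<open>Means of the sign characters under the squared spectrum\<close>

definition fourier_mean :: "nat \<Rightarrow> (bool list \<Rightarrow> bool) \<Rightarrow> nat \<Rightarrow> real" where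
  "fourier_mean n g k = (\<Sum>s\<in>bitstrings n. (fourier n g s)\<^sup>2 * bsign (s ! k))"

text \<open>The squared spectrum is the point mass at the zero string, where every sign is
  1.\<close>

lemma fourier_mean_const:
  assumes "\<And>z. z \<in> bitstrings n \<Longrightarrow> g z = c" "k < n"
  shows "fourier_mean n g k = 1"
proof -
  have "fourier_mean n g k
      = (\<Sum>s\<in>bitstrings n. if s = replicate n False then 1 else 0)"
    unfolding fourier_mean_def
    by (intro sum.cong refl) (use assms(2) in \<open>auto simp: fourier_const[OF assms(1)] bsign_def\<close>)
  moreover have "replicate n False \<in> bitstrings n" by (simp add: bitstrings_def)
  ultimately show ?thesis by simp
qed

text \<open>A single set bit \<open>j\<close> already lowers the sum from n to n - 2, and further
  set bits only lower it more.\<close>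

lemma sum_bsign_le:
  assumes "s \<in> bitstrings n" "s \<noteq> replicate n False"
  shows "(\<Sum>k<n. bsign (s ! k)) \<le> real n - 2"
proof -
  obtain j where j: "j < n" "s ! j"
    using assms by (auto simp: bitstrings_def list_eq_iff_nth_eq)
  have "(\<Sum>k<n. bsign (s ! k)) \<le> (\<Sum>k<n. 1 - 2 * of_bool (k = j))"
    using j by (intro sum_mono) (auto simp: bsign_def)
  also have "\<dots> = real n - 2"
    using j by (simp add: sum_subtractf flip: sum_distrib_left)
  finally show ?thesis .
qed

text \<open>The zero string has weight 0, every other string satisfies \<open>sum_bsign_le\<close>,
  and by Parseval the weights add up to 1.\<close>

lemma sum_fourier_mean_balanced:
  assumes "balanced_fun n f"
  shows "(\<Sum>k<n. fourier_mean n f k) \<le> real n - 2"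
proof -
  have "(\<Sum>k<n. fourier_mean n f k) = (\<Sum>s\<in>bitstrings n. (fourier n f s)\<^sup>2 * (\<Sum>k<n. bsign (s ! k)))"
    unfolding fourier_mean_def sum_distrib_left by (rule sum.swap)
  also have "\<dots> \<le> (\<Sum>s\<in>bitstrings n. (fourier n f s)\<^sup>2 * (real n - 2))"
  proof (rule sum_mono)
    fix s assume "s \<in> bitstrings n"
    then show "(fourier n f s)\<^sup>2 * (\<Sum>k<n. bsign (s ! k)) \<le> (fourier n f s)\<^sup>2 * (real n - 2)"
      using fourier_balanced[OF assms] sum_bsign_le
      by (cases "s = replicate n False") (auto intro: mult_left_mono)
  qed
  also have "\<dots> = real n - 2"
    by (simp add: parseval flip: sum_distrib_right)
  finally show ?thesis .
qed

section \<open>The expectation of Z on an output qubit\<close>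

lemma sum_mix_weight_bsign:
  assumes "k < n"
  shows "(\<Sum>x\<in>bitstrings n. (\<Prod>j<n. mix_weight (p (Suc j)) (x ! j)) * bsign (x ! k)) = 2 * p (Suc k) - 1"
proof -
  \<comment> \<open>Padding the sign at \<open>k\<close> with ones at all other positions makes the
    summand a product over bits.\<close>
  have "(\<Sum>x\<in>bitstrings n. (\<Prod>j<n. mix_weight (p (Suc j)) (x ! j)) * bsign (x ! k))
      = (\<Sum>x\<in>bitstrings n. \<Prod>j<n. mix_weight (p (Suc j)) (x ! j) * (if j = k then bsign (x ! j) else 1))"
    using assms by (simp add: prod.distrib)
  \<comment> \<open>Position \<open>k\<close> contributes p - (1 - p), any other position p + (1 -
    p) = 1.\<close>
  also have "\<dots> = (\<Prod>j<n. if j = k then 2 * p (Suc j) - 1 else 1)"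
    unfolding sum_prod_bitstrings[where
        g = "\<lambda>j b. mix_weight (p (Suc j)) b * (if j = k then bsign b else 1)"]
    by (intro prod.cong) (auto simp: mix_weight_def)
  also have "\<dots> = 2 * p (Suc k) - 1"
    using assms by simp
  finally show ?thesis .
qed

text \<open>The common source of both claims. The output is \<open>bxor x s\<close> with
  \<open>x\<close> drawn from the input and \<open>s\<close> independently from a squared spectrum:
  that of the zero function with weight \<open>r\<close> (work bit 0), that of \<open>f\<close> with
  weight \<open>1 - r\<close>. The sign at \<open>k\<close> is multiplicative, so the mean
  factors.\<close>

lemma expect_Z_dj_output:
  assumes "k < n"
  shows "expect_Z n (Suc k) (dj_output n f (dj_input n (\<lambda>j. qubit_mix (p j)) (qubit_mix r)))
      = complex_of_real ((2 * p (Suc k) - 1) * (r + (1 - r) * fourier_mean n f k))"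
proof -
  let ?P = "\<lambda>x. \<Prod>j<n. mix_weight (p (Suc j)) (x ! j)"
  let ?w = "\<lambda>y x. (cmod (entry (dj_circuit n f) y x))\<^sup>2
      * ((\<Prod>j<n. mix_weight (p (Suc j)) (x ! j)) * mix_weight r (x ! n)) * bsign (y ! k)"
  let ?F = "\<lambda>a s. (fourier n (\<lambda>z. a \<and> f z) s)\<^sup>2"
  have nth_snoc: "(\<Prod>j<n. mix_weight (p (Suc j)) ((x @ [a]) ! j)) = ?P x"
      "(x @ [a]) ! n = a" "(x @ [a]) ! k = x ! k"
    if "x \<in> bitstrings n" for x a
    using that assms by (auto simp: bitstrings_def nth_append intro!: prod.cong)
  have prob: "(cmod (entry (dj_circuit n f) (y @ [b]) (x @ [a])))\<^sup>2 = of_bool (a = b) * ?F b (bxor x y)"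
    if "x \<in> bitstrings n" "y \<in> bitstrings n" for x y a b
    unfolding entry_dj_circuit[OF that] norm_of_real power2_abs by simp
  have "expect_Z n (Suc k) (dj_output n f (dj_input n (\<lambda>j. qubit_mix (p j)) (qubit_mix r)))
      = complex_of_real (\<Sum>y\<in>bitstrings (Suc n). \<Sum>x\<in>bitstrings (Suc n). ?w y x)"
    unfolding expect_Z_def dj_output_def
    by (rule mat_trace_conjugate_diagonal)
      (rule dj_circuit_carrier dj_input_carrier qubit_mix_carrier Z_on_carrier entry_dj_input
        entry_Z_on assms | assumption)+
  \<comment> \<open>Of the four pairs of input and output work bits only the two equal pairs
    survive.\<close>
  also have "(\<Sum>y\<in>bitstrings (Suc n). \<Sum>x\<in>bitstrings (Suc n). ?w y x)
      = (\<Sum>y\<in>bitstrings n. \<Sum>x\<in>bitstrings n.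
      (r * ?F False (bxor x y) + (1 - r) * ?F True (bxor x y)) * ?P x * bsign (y ! k))"
    unfolding sum_bitstrings_snoc sum.distrib[symmetric]
  proof (intro sum.cong refl)
    have distrib: "F * (P * r) * c + F' * (P * (1 - r)) * c = (r * F + (1 - r) * F') * P * c" for F F' P c
      by (simp add: algebra_simps)
    fix y x assume "y \<in> bitstrings n" "x \<in> bitstrings n"
    then show "?w (y @ [False]) (x @ [False]) + ?w (y @ [False]) (x @ [True])
        + (?w (y @ [True]) (x @ [False]) + ?w (y @ [True]) (x @ [True]))
        = (r * ?F False (bxor x y) + (1 - r) * ?F True (bxor x y)) * ?P x * bsign (y ! k)"
      by (simp only: nth_snoc prob mix_weight_simps of_bool_eq simp_thms
          bool.distinct mult_zero_left mult_1 add_0_left add_0_right distrib)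
  qed
  also have "(\<Sum>y\<in>bitstrings n. \<Sum>x\<in>bitstrings n.
      (r * ?F False (bxor x y) + (1 - r) * ?F True (bxor x y)) * ?P x * bsign (y ! k))
      = (\<Sum>x\<in>bitstrings n. \<Sum>s\<in>bitstrings n.
      (?P x * bsign (x ! k)) * ((r * ?F False s + (1 - r) * ?F True s) * bsign (s ! k)))"
  proof (subst sum.swap, rule sum.cong, rule refl)
    fix x assume x: "x \<in> bitstrings n"
    \<comment> \<open>Substituting y = \<open>bxor x s\<close> removes \<open>x\<close> from the
      spectrum and splits the sign of \<open>y\<close> into those of \<open>x\<close> and
      \<open>s\<close>.\<close>
    have "(\<Sum>y\<in>bitstrings n. (r * ?F False (bxor x y) + (1 - r) * ?F True (bxor x y)) * ?P x * bsign (y ! k))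
      = (\<Sum>s\<in>bitstrings n. (r * ?F False (bxor x (bxor x s)) + (1 - r) * ?F True (bxor x (bxor x s))) * ?P x
            * bsign (bxor x s ! k))"
      by (rule sum.reindex_bij_betw[OF bij_betw_bxor[OF x], symmetric])
    also have "\<dots> = (\<Sum>s\<in>bitstrings n. (?P x * bsign (x ! k))
        * ((r * ?F False s + (1 - r) * ?F True s) * bsign (s ! k)))"
      using x assms
      by (intro sum.cong refl) (simp only: bxor_bxor_cancel nth_bxor bsign_neq mult_ac)
    finally show "(\<Sum>y\<in>bitstrings n. (r * ?F False (bxor x y) + (1 - r) * ?F True (bxor x y)) * ?P x * bsign (y ! k))
      = (\<Sum>s\<in>bitstrings n. (?P x * bsign (x ! k))
        * ((r * ?F False s + (1 - r) * ?F True s) * bsign (s ! k)))" .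
  qed
  also have "\<dots> = (\<Sum>x\<in>bitstrings n. ?P x * bsign (x ! k))
      * (r * fourier_mean n (\<lambda>z. False) k + (1 - r) * fourier_mean n f k)"
    unfolding sum_product[symmetric]
    by (simp add: fourier_mean_def sum_distrib_left sum.distrib distrib_right mult.assoc)
  \<comment> \<open>The spectrum for work bit 0 belongs to a constant function, so its mean is
    1.\<close>
  also have "\<dots> = (2 * p (Suc k) - 1) * (r + (1 - r) * fourier_mean n f k)"
    using assms by (simp add: sum_mix_weight_bsign fourier_mean_const[where c = False])
  finally show ?thesis .
qed

theorem mainTheorem5:
  fixes n :: nat and f :: "bool list \<Rightarrow> bool"
  assumes "constant_fun n f \<or> balanced_fun n f"
  shows "(\<forall>p :: nat \<Rightarrow> real. (\<forall>j\<in>{1..n}. 0 \<le> p j \<and> p j \<le> 1) \<longrightarrow>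
            (\<forall>i\<in>{1..n}.
              expect_Z n i (dj_output n f (dj_input n (\<lambda>j. qubit_mix (p j)) (proj True)))
              = complex_of_real (2 * p i - 1) *
                expect_Z n i (dj_output n f (dj_input n (\<lambda>j. proj False) (proj True)))))
       \<and> (\<forall>p :: real. 1 / 2 < p \<and> p \<le> 1 \<longrightarrow>
            (let \<rho> = dj_output n f (dj_input n (\<lambda>j. qubit_mix p)
                   (complex_of_real p \<cdot>\<^sub>m proj True + complex_of_real (1 - p) \<cdot>\<^sub>m proj False))
             in (constant_fun n f \<longrightarrow>
                   (\<Sum>i = 1..n. expect_Z n i \<rho>) = complex_of_real ((2 * p - 1) * real n)) \<and>
                (balanced_fun n f \<longrightarrow>
                   (\<Sum>i = 1..n. expect_Z n i \<rho>) \<le> complex_of_real ((2 * p - 1) * (real n - 2 * p)))))"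
proof (intro conjI allI impI ballI, goal_cases)
  case (1 p i)
  then obtain k where "i = Suc k" "k < n"
    by (cases i) auto
  \<comment> \<open>Both sides are instances with \<open>r = 0\<close>, the work qubit being in |1>.
    The pure input is the case where all weights are 1, with prefactor 2 * 1 - 1 = 1.\<close>
  then show ?case
    using expect_Z_dj_output[of k n f p 0] expect_Z_dj_output[of k n f "\<lambda>_. 1" 0]
    by (simp add: qubit_mix_0_1)
next
  case (2 p)
  define \<rho> where "\<rho> = dj_output n f (dj_input n (\<lambda>j. qubit_mix p) (qubit_mix (1 - p)))"
  have "(\<Sum>i = 1..n. expect_Z n i \<rho>)
      = complex_of_real (\<Sum>k<n. (2 * p - 1) * (1 - p + p * fourier_mean n f k))"
    using expect_Z_dj_output[of _ n f "\<lambda>_. p" "1 - p"]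
    by (simp add: \<rho>_def sum.atLeast1_atMost_eq)
  also have "(\<Sum>k<n. (2 * p - 1) * (1 - p + p * fourier_mean n f k))
      = (2 * p - 1) * (real n * (1 - p) + p * (\<Sum>k<n. fourier_mean n f k))"
    by (simp add: sum.distrib flip: sum_distrib_left)
  finally have sum: "(\<Sum>i = 1..n. expect_Z n i \<rho>)
      = complex_of_real ((2 * p - 1) * (real n * (1 - p) + p * (\<Sum>k<n. fourier_mean n f k)))" .
  have const: "(\<Sum>i = 1..n. expect_Z n i \<rho>) = complex_of_real ((2 * p - 1) * real n)"
    if "constant_fun n f"
  proof -
    from that obtain c where "\<And>z. z \<in> bitstrings n \<Longrightarrow> f z = c"
      by (auto simp: constant_fun_def)
    then have "fourier_mean n f k = 1" if "k < n" for k
      using that by (rule fourier_mean_const)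
    then show ?thesis unfolding sum by (simp add: algebra_simps)
  qed
  have bal: "(\<Sum>i = 1..n. expect_Z n i \<rho>) \<le> complex_of_real ((2 * p - 1) * (real n - 2 * p))"
    if "balanced_fun n f"
  proof -
    have "p * (\<Sum>k<n. fourier_mean n f k) \<le> p * (real n - 2)"
      using 2 sum_fourier_mean_balanced[OF that] by (intro mult_left_mono) auto
    \<comment> \<open>The bound comes from n (1 - p) + p (n - 2) = n - 2 p, and the factor 2 p - 1
      is positive.\<close>
    then have "(2 * p - 1) * (real n * (1 - p) + p * (\<Sum>k<n. fourier_mean n f k))
        \<le> (2 * p - 1) * (real n - 2 * p)"
      using 2 by (intro mult_left_mono) (auto simp: algebra_simps)
    \<comment> \<open>Both sides are embedded reals, so the complex order reduces to the real
      one.\<close>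
    then show ?thesis unfolding sum by (simp add: less_eq_complex_def)
  qed
  show ?case
    unfolding Let_def qubit_mix_flip \<rho>_def[symmetric] using const bal by blast
qed

end
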